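(* Let $p>2$ be prime. For $n\ge3$ let $R_2(n)=X_1X_2+X_2X_3+\cdots+X_{n-1}X_n+X_nX_1\in\mathbb{F}_p[X_1,\dots,X_n]$. Then the sequence $\{S_{\mathbb{F}_p}(R_2(n))\}$ satisfies the homogeneous linear recurrence with characteristic polynomial $Q_{R,2,\mathbb{F}_p}(X)=X^4-p^2$, i.e. $S_{\mathbb{F}_p}(R_2(n))=p^2S_{\mathbb{F}_p}(R_2(n-4))$.
   Context: For $F\in\mathbb{F}_p[X_1,\dots,X_n]$, $S_{\mathbb{F}_p}(F)=\sum_{\mathbf{x}\in\mathbb{F}_p^n}e^{\frac{2\pi i}{p}F(\mathbf{x})}$ (with $F(\mathbf{x})$ viewed as an integer mod $p$). *)

theory Defs
  imports
    "HOL-Analysis.Analysis"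
    "HOL-Library.Poly_Mapping"
    "HOL-Computational_Algebra.Polynomial"
    "Berlekamp_Zassenhaus.Finite_Field"
begin

text \<open>The field with \<open>p\<close> elements is \<^typ>\<open>'p::prime_card mod_ring\<close>, with \<open>p = CARD('p)\<close>.
  A multivariate polynomial is a finitely supported map from monomials to coefficients, a monomial
  being a finitely supported map from variable indices to exponents.  The variables are
  \<open>X\<^sub>1, X\<^sub>2, \<dots>\<close>; index \<open>0\<close> is not used.\<close>

type_synonym 'a mpoly = "(nat \<Rightarrow>\<^sub>0 nat) \<Rightarrow>\<^sub>0 'a"

definition mvar :: "nat \<Rightarrow> 'a::comm_ring_1 mpoly" where
  "mvar i = Poly_Mapping.single (Poly_Mapping.single i 1) 1"

definition mpoly_eval :: "(nat \<Rightarrow> 'a::comm_ring_1) \<Rightarrow> 'a mpoly \<Rightarrow> 'a" where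
  "mpoly_eval x F =
     (\<Sum>m\<in>Poly_Mapping.keys F.
        Poly_Mapping.lookup F m *
        (\<Prod>i\<in>Poly_Mapping.keys m. x i ^ Poly_Mapping.lookup m i))"

text \<open>The number \<open>n\<close> of variables is an explicit argument, since it is not determined by \<open>F\<close>; the
  definition is meant for \<open>F\<close> in the variables \<open>X\<^sub>1, \<dots>, X\<^sub>n\<close> only.  Points of the \<open>n\<close>-dimensional
  space are the extensional functions on \<open>{1..n}\<close>, and \<^const>\<open>to_int_mod_ring\<close> picks the integer
  representative in \<open>{0..<p}\<close>.\<close>

definition exp_sum :: "nat \<Rightarrow> 'p::prime_card mod_ring mpoly \<Rightarrow> complex" where
  "exp_sum n F =
     (\<Sum>x \<in> {1..n} \<rightarrow>\<^sub>E (UNIV :: 'p mod_ring set).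
        exp (2 * of_real pi * \<i> / of_nat CARD('p) * of_int (to_int_mod_ring (mpoly_eval x F))))"

definition R2 :: "nat \<Rightarrow> 'a::comm_ring_1 mpoly" where
  "R2 n = (\<Sum>i\<in>{1..<n}. mvar i * mvar (i + 1)) + mvar n * mvar 1"

text \<open>The sequence \<open>(a n)\<close>, indexed by \<open>n \<ge> N\<close>, satisfies the homogeneous linear recurrence with
  (monic) characteristic polynomial \<open>Q\<close>; values of \<open>a\<close> below \<open>N\<close> are irrelevant.\<close>

definition satisfies_linear_recurrence ::
    "nat \<Rightarrow> 'a::comm_ring_1 poly \<Rightarrow> (nat \<Rightarrow> 'a) \<Rightarrow> bool" where
  "satisfies_linear_recurrence N Q a \<longleftrightarrow>
     Polynomial.lead_coeff Q = 1 \<and>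
     (\<forall>n\<ge>N. (\<Sum>i\<le>Polynomial.degree Q. Polynomial.coeff Q i * a (n + i)) = 0)"

end

theory Submission
  imports Defs
begin

text \<open>Let \<open>M\<close> be the matrix with entries \<open>\<psi>(ab)\<close>, indexed by the field elements, where \<open>\<psi>\<close> is the
  standard additive character.  Since \<open>R\<^sub>2(n)\<close> is a closed cyclic chain, its exponential sum is the
  trace of \<open>M\<^sup>n\<close>.  Orthogonality of characters gives \<open>M\<^sup>2 = p J\<close> with \<open>J\<close> the permutation matrix of
  \<open>a \<mapsto> -a\<close>, hence \<open>M\<^sup>4 = p\<^sup>2 I\<close>.\<close>

definition add_char :: "'p::prime_card mod_ring \<Rightarrow> complex" where
  "add_char a = exp (2 * of_real pi * \<i> / of_nat CARD('p) * of_int (to_int_mod_ring a))"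

lemma add_char_0 [simp]: "add_char 0 = 1"
  by (simp add: add_char_def)

lemma add_char_add: "add_char (a + b) = add_char a * add_char (b :: 'p::prime_card mod_ring)"
proof -
  let ?p = "int CARD('p)"
  define s where "s = to_int_mod_ring a + to_int_mod_ring b"
  have "to_int_mod_ring (a + b) = s mod ?p"
    unfolding s_def by transfer simp
  then have s: "to_int_mod_ring (a + b) = s - ?p * (s div ?p)"
    by (simp add: minus_mult_div_eq_mod)
  \<comment> \<open>Reducing the sum of representatives modulo \<open>?p\<close> shifts the exponent
    by an integer multiple of 2 pi i, which \<open>exp\<close> does not see.\<close>
  have "2 * of_real pi * \<i> / of_nat CARD('p) * of_int (to_int_mod_ring (a + b)) =
        2 * of_real pi * \<i> / of_nat CARD('p) * of_int (to_int_mod_ring a) +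
        2 * of_real pi * \<i> / of_nat CARD('p) * of_int (to_int_mod_ring b) -
        2 * of_int (s div ?p) * of_real pi * \<i>"
    unfolding s by (simp add: s_def field_simps)
  moreover have "exp (2 * of_int (s div ?p) * of_real pi * \<i>) = 1"
    by (auto simp: exp_eq_1)
  ultimately show ?thesis
    by (simp only: add_char_def exp_add exp_diff div_by_1)
qed

lemma add_char_1_neq_1: "add_char (1 :: 'p::prime_card mod_ring) \<noteq> 1"
proof
  assume "add_char (1 :: 'p mod_ring) = 1"
  then obtain k :: int where "2 * pi / real CARD('p) = of_int (2 * k) * pi"
    by (auto simp: add_char_def exp_eq_1)
  then have "1 = of_int k * real CARD('p)"
    by (simp add: field_simps)
  then have "1 = k * int CARD('p)"
    by (metis of_int_1 of_int_eq_iff of_int_mult of_int_of_nat_eq)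
  then have "int CARD('p) dvd 1"
    by (metis dvd_triv_right)
  then show False
    using prime_card[where 'a = 'p] by auto
qed

text \<open>Orthogonality of characters. For nonzero \<open>a\<close>, translating \<open>c\<close>
  by \<open>inverse a\<close> multiplies the sum by \<open>add_char 1\<close>, which is not 1, so
  the sum vanishes.\<close>

lemma sum_add_char_mult:
  fixes a :: "'p::prime_card mod_ring"
  shows "(\<Sum>c\<in>UNIV. add_char (c * a)) = of_nat CARD('p) * of_bool (a = 0)"
proof (cases "a = 0")
  case False
  let ?S = "\<Sum>c\<in>UNIV. add_char (c * a)"
  have "?S = (\<Sum>c\<in>UNIV. add_char ((c + inverse a) * a))"
    by (rule sum.reindex_bij_witness[of _ "\<lambda>c. c + inverse a" "\<lambda>c. c - inverse a"]) auto
  also have "\<dots> = ?S * add_char (1 :: 'p mod_ring)"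
    using False by (simp add: distrib_right add_char_add sum_distrib_right)
  finally have "?S * (add_char (1 :: 'p mod_ring) - 1) = 0"
    by (simp add: right_diff_distrib)
  then show ?thesis
    using False add_char_1_neq_1[where 'p = 'p] by simp
qed simp

text \<open>These are the entries of the powers of \<open>M\<close>. Multiplying by \<open>M\<close>
  on the right matches a chain that grows at its last vertex.\<close>

primrec char_matrix_pow :: "nat \<Rightarrow> 'p::prime_card mod_ring \<Rightarrow> 'p mod_ring \<Rightarrow> complex" where
  "char_matrix_pow 0 a b = of_bool (a = b)"
| "char_matrix_pow (Suc n) a b = (\<Sum>c\<in>UNIV. char_matrix_pow n a c * add_char (c * b))"

text \<open>The two added factors have a common middle index \<open>c\<close>, and their product is
  \<open>add_char (c * (d + b))\<close>. Summing over \<open>c\<close> first, orthogonality leaves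
  only \<open>d = - b\<close>.\<close>

lemma char_matrix_pow_add_2:
  fixes a b :: "'p::prime_card mod_ring"
  shows "char_matrix_pow (Suc (Suc n)) a b = of_nat CARD('p) * char_matrix_pow n a (- b)"
proof -
  have "char_matrix_pow (Suc (Suc n)) a b =
      (\<Sum>c\<in>UNIV. \<Sum>d\<in>UNIV. char_matrix_pow n a d * add_char (c * (d + b)))"
    by (simp add: sum_distrib_right add_char_add distrib_left mult.assoc)
      (simp only: mult.commute)
  also have "\<dots> = (\<Sum>d\<in>UNIV. char_matrix_pow n a d * (\<Sum>c\<in>UNIV. add_char (c * (d + b))))"
    by (subst sum.swap) (simp add: sum_distrib_left)
  also have "\<dots> = (\<Sum>d\<in>UNIV. if d = - b then of_nat CARD('p) * char_matrix_pow n a d else 0)"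
    unfolding sum_add_char_mult by (intro sum.cong) (auto simp: add_eq_0_iff2)
  finally show ?thesis
    by simp
qed

text \<open>Two double steps negate the column index twice, so the sign cancels and the factor
  \<open>p\<close> is squared.\<close>

lemma char_matrix_pow_add_4:
  fixes a b :: "'p::prime_card mod_ring"
  shows "char_matrix_pow (n + 4) a b = of_nat CARD('p) ^ 2 * char_matrix_pow n a b"
proof -
  have "n + 4 = Suc (Suc (Suc (Suc n)))"
    by simp
  then show ?thesis
    by (simp only: char_matrix_pow_add_2) (simp add: power2_eq_square)
qed

lemma sum_PiE_insert:
  assumes "i \<notin> I"
  shows "(\<Sum>x\<in>insert i I \<rightarrow>\<^sub>E A. f x) = (\<Sum>x\<in>I \<rightarrow>\<^sub>E A. \<Sum>y\<in>A. f (x(i := y)))"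
proof -
  have "(\<Sum>x\<in>insert i I \<rightarrow>\<^sub>E A. f x) = (\<Sum>(y, x)\<in>A \<times> (I \<rightarrow>\<^sub>E A). f (x(i := y)))"
    unfolding PiE_insert_eq
    by (subst sum.reindex[OF inj_combinator[OF assms]]) (simp add: case_prod_unfold o_def)
  also have "\<dots> = (\<Sum>x\<in>I \<rightarrow>\<^sub>E A. \<Sum>y\<in>A. f (x(i := y)))"
    by (subst sum.cartesian_product[symmetric], subst sum.swap) simp
  finally show ?thesis .
qed

text \<open>An open chain with \<open>n\<close> edges and \<open>n + 1\<close> vertices. The weight
  \<open>g\<close> on the two ends is arbitrary for two reasons: the induction changes it at each
  step, and a suitable choice later closes the chain to a cycle.\<close>

lemma sum_chain_eq_char_matrix_pow:
  fixes g :: "'p::prime_card mod_ring \<Rightarrow> 'p mod_ring \<Rightarrow> complex"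
  shows "(\<Sum>x\<in>{1..Suc n} \<rightarrow>\<^sub>E UNIV. add_char (\<Sum>i\<in>{1..<Suc n}. x i * x (i + 1)) * g (x 1) (x (Suc n))) =
    (\<Sum>a\<in>UNIV. \<Sum>b\<in>UNIV. char_matrix_pow n a b * g a b)"
proof (induction n arbitrary: g)
  case 0
  \<comment> \<open>With one vertex both ends coincide, which matches the identity matrix.\<close>
  have "{1..Suc 0} = insert 1 {}"
    by auto
  then show ?case
    by (simp add: sum_PiE_insert)
next
  case (Suc n)
  have ins: "{1..Suc (Suc n)} = insert (Suc (Suc n)) {1..Suc n}"
    by auto
  have chain: "(\<Sum>i\<in>{1..<Suc (Suc n)}. (x(Suc (Suc n) := y)) i * (x(Suc (Suc n) := y)) (i + 1)) =
      (\<Sum>i\<in>{1..<Suc n}. x i * x (i + 1)) + x (Suc n) * y"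
    for x :: "nat \<Rightarrow> 'p mod_ring" and y
  proof -
    have "{1..<Suc (Suc n)} = insert (Suc n) {1..<Suc n}"
      by auto
    then show ?thesis
      by (simp add: add.commute)
  qed
  \<comment> \<open>Summing out the new last vertex \<open>y\<close> absorbs the new edge into the
    weight. The induction hypothesis is then used with the inner sum over \<open>y\<close> in place
    of \<open>g\<close>.\<close>
  have "(\<Sum>x\<in>{1..Suc (Suc n)} \<rightarrow>\<^sub>E UNIV.
          add_char (\<Sum>i\<in>{1..<Suc (Suc n)}. x i * x (i + 1)) * g (x 1) (x (Suc (Suc n)))) =
      (\<Sum>x\<in>{1..Suc n} \<rightarrow>\<^sub>E UNIV. add_char (\<Sum>i\<in>{1..<Suc n}. x i * x (i + 1)) *
          (\<Sum>y\<in>UNIV. add_char (x (Suc n) * y) * g (x 1) y))"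
    unfolding ins by (subst sum_PiE_insert) (auto simp only: chain add_char_add,
      auto simp: sum_distrib_left mult.assoc)
  also have "\<dots> = (\<Sum>a\<in>UNIV. \<Sum>c\<in>UNIV. char_matrix_pow n a c * (\<Sum>b\<in>UNIV. add_char (c * b) * g a b))"
    by (rule Suc.IH)
  also have "\<dots> = (\<Sum>a\<in>UNIV. \<Sum>b\<in>UNIV. char_matrix_pow (Suc n) a b * g a b)"
    by (simp add: sum_distrib_left sum_distrib_right mult.assoc) (subst sum.swap, rule refl)
  finally show ?case .
qed

lemma mpoly_eval_0 [simp]: "mpoly_eval x 0 = 0"
  by (simp add: mpoly_eval_def)

lemma mpoly_eval_add: "mpoly_eval x (F + G) = mpoly_eval x F + mpoly_eval x G"
  unfolding mpoly_eval_def by (rule setsum_keys_plus_distrib) (simp_all add: distrib_right)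

lemma mpoly_eval_sum: "mpoly_eval x (\<Sum>i\<in>I. F i) = (\<Sum>i\<in>I. mpoly_eval x (F i))"
  by (induction I rule: infinite_finite_induct) (simp_all add: mpoly_eval_add)

text \<open>Distinct indices make the product a single monomial with exponent 1 at \<open>i\<close>
  and at \<open>j\<close>, so the evaluation has one term.\<close>

lemma mpoly_eval_mvar_mult:
  assumes "i \<noteq> j"
  shows "mpoly_eval x (mvar i * mvar j) = x i * x j"
proof -
  let ?m = "Poly_Mapping.single i 1 + Poly_Mapping.single j (1 :: nat)"
  have "Poly_Mapping.keys ?m = {i, j}"
    using assms by (auto simp: in_keys_iff lookup_add lookup_single when_def split: if_splits)
  then show ?thesis
    using assms by (simp add: mpoly_eval_def mvar_def mult_single lookup_add lookup_single)
qed

lemma mpoly_eval_R2: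
  assumes "n \<ge> 2"
  shows "mpoly_eval x (R2 n) = (\<Sum>i\<in>{1..<n}. x i * x (i + 1)) + x n * x 1"
  using assms by (simp add: R2_def mpoly_eval_add mpoly_eval_sum mpoly_eval_mvar_mult)

lemma exp_sum_R2_eq_trace:
  assumes "n \<ge> 2"
  shows "exp_sum n (R2 n :: 'p::prime_card mod_ring mpoly) =
    (\<Sum>a\<in>UNIV. char_matrix_pow n a (a :: 'p mod_ring))"
proof -
  obtain m where n: "n = Suc m"
    using assms by (cases n) auto
  have "exp_sum n (R2 n :: 'p mod_ring mpoly) = (\<Sum>x\<in>{1..Suc m} \<rightarrow>\<^sub>E UNIV.
      add_char (\<Sum>i\<in>{1..<Suc m}. x i * x (i + 1)) * add_char (x (Suc m) * (x 1 :: 'p mod_ring)))"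
    unfolding exp_sum_def add_char_def[symmetric] mpoly_eval_R2[OF assms] add_char_add
    by (simp only: n)
  also have "\<dots> = (\<Sum>a\<in>UNIV. char_matrix_pow n a (a :: 'p mod_ring))"
    \<comment> \<open>This weight is the closing edge from the last vertex back to the first. The
      sum over \<open>b\<close> then supplies one more factor of \<open>M\<close>, and the sum over
      \<open>a\<close> takes the trace.\<close>
    by (subst sum_chain_eq_char_matrix_pow[where g = "\<lambda>a b. add_char (b * a)"]) (simp add: n)
  finally show ?thesis .
qed

lemma exp_sum_R2_add_4:
  assumes "n \<ge> 2"
  shows "exp_sum (n + 4) (R2 (n + 4) :: 'p::prime_card mod_ring mpoly) =
    of_nat CARD('p) ^ 2 * exp_sum n (R2 n :: 'p mod_ring mpoly)"
  using assms
  by (simp add: exp_sum_R2_eq_trace char_matrix_pow_add_4 sum_distrib_left del: char_matrix_pow.simps)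

text \<open>Since \<open>k > 0\<close>, the constant does not meet the leading term: the polynomial
  is monic of degree \<open>k\<close>, and only its coefficients at 0 and \<open>k\<close> can
  contribute.\<close>

lemma satisfies_linear_recurrence_monom_minus_const:
  assumes "k > 0"
  shows "satisfies_linear_recurrence N (Polynomial.monom 1 k - [:c:]) a \<longleftrightarrow>
    (\<forall>n\<ge>N. a (n + k) = c * a n)"
proof -
  let ?Q = "Polynomial.monom 1 k - [:c:]"
  have coeff: "Polynomial.coeff ?Q i = of_bool (i = k) - (if i = 0 then c else 0)" for i
    by (auto simp: coeff_pCons split: nat.splits)
  have "Polynomial.degree ?Q \<le> k"
    by (rule degree_le) (use assms in \<open>auto simp: coeff simp del: coeff_diff\<close>)
  then have deg: "Polynomial.degree ?Q = k"
    using assms by (intro antisym le_degree) (simp_all add: coeff del: coeff_diff)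
  have "(\<Sum>i\<le>k. Polynomial.coeff ?Q i * a (n + i)) = a (n + k) - c * a n" for n
  proof -
    have "(\<Sum>i\<le>k. Polynomial.coeff ?Q i * a (n + i)) =
        (\<Sum>i\<le>k. if i = k then a (n + i) else 0) - (\<Sum>i\<le>k. if i = 0 then c * a (n + i) else 0)"
      unfolding sum_subtractf[symmetric]
      by (intro sum.cong) (use assms in \<open>auto simp: coeff simp del: coeff_diff\<close>)
    then show ?thesis
      by simp
  qed
  then show ?thesis
    using assms by (simp add: satisfies_linear_recurrence_def deg coeff del: coeff_diff)
qed

theorem theorem3p5:
  assumes "CARD('p::prime_card) > 2"
  shows "satisfies_linear_recurrence 3
           (Polynomial.monom 1 4 - [:of_nat CARD('p) ^ 2:])
           (\<lambda>n. exp_sum n (R2 n :: 'p mod_ring mpoly)) \<and>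
         (\<forall>n. n \<ge> 7 \<longrightarrow>
           exp_sum n (R2 n :: 'p mod_ring mpoly) =
             of_nat CARD('p) ^ 2 * exp_sum (n - 4) (R2 (n - 4) :: 'p mod_ring mpoly))"
proof (intro conjI allI impI)
  show "satisfies_linear_recurrence 3
      (Polynomial.monom 1 4 - [:of_nat CARD('p) ^ 2:])
      (\<lambda>n. exp_sum n (R2 n :: 'p mod_ring mpoly))"
    by (subst satisfies_linear_recurrence_monom_minus_const) (simp_all add: exp_sum_R2_add_4)
next
  fix n :: nat
  assume "n \<ge> 7"
  then show "exp_sum n (R2 n :: 'p mod_ring mpoly) =
      of_nat CARD('p) ^ 2 * exp_sum (n - 4) (R2 (n - 4) :: 'p mod_ring mpoly)"
    \<comment> \<open>From \<open>n \<ge> 7\<close> it follows that \<open>n - 4 \<ge> 3\<close>, so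
      the shift by 4 applies and \<open>n - 4 + 4\<close> is again \<open>n\<close> despite
      truncated subtraction.\<close>
    using exp_sum_R2_add_4[of "n - 4", where 'p = 'p] by simp
qed

end
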